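(* Let $U \sim \mathcal{GP}(\mu,\Sigma)$ and let $U^n$ be the Gaussian process $\mathcal{GP}(\mu^n,\Sigma^n)$ obtained by the sequential conditioning procedure defined in the context (assimilate the initial data $U(\boldsymbol{a}_0) = g(\boldsymbol{a}_0)$ to get $U^0$; then for $i = 0,1,\dots,n-1$ assimilate $[U(\boldsymbol{b}_i)^\top, D_iU(\boldsymbol{v}_i)^\top]^\top = [h(\boldsymbol{b}_i)^\top, f(\boldsymbol{v}_i)^\top]^\top$ into $U^i$ to get $U^{i+1}$). Then $U^n$ is identical in distribution (i.e. it has the same mean function and the same covariance function) to the Gaussian process obtained when $U \sim \mathcal{GP}(\mu,\Sigma)$ is conditioned, all at once, on the dataset $$\left[\begin{array}{c} U(\boldsymbol{a}_0) \\ U(\boldsymbol{b}_0) \\ D_0U(\boldsymbol{v}_0) \\ \vdots \\ U(\boldsymbol{b}_{n-1}) \\ D_{n-1}U(\boldsymbol{v}_{n-1}) \end{array}\right] = \left[\begin{array}{c} g(\boldsymbol{a}_0) \\ h(\boldsymbol{b}_0) \\ f(\boldsymbol{v}_0) \\ \vdots \\ h(\boldsymbol{b}_{n-1}) \\ f(\boldsymbol{v}_{n-1}) \end{array}\right].$$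
   Context: Setting. $T \in (0,\infty)$, $\Gamma \subset \mathbb{R}^d$ is open and bounded with boundary $\partial\Gamma$, and $E = [0,T] \times (\Gamma \cup \partial\Gamma)$. Fix times $0 = t_0 < t_1 < \dots < t_{n-1} \le T$ and a finite set $\mathbf{x}$ of $m$ distinct points of $\Gamma \cup \partial\Gamma$. Let $\boldsymbol{a}_0$ be the (ordered) list of points $(t_0,x)$ with $x \in \mathbf{x} \setminus \partial\Gamma$; let $\boldsymbol{b}_i$ be the list of points $(t_i,x)$ with $x \in \mathbf{x} \cap \partial\Gamma$; let $\boldsymbol{v}_i$ be the list of points $(t_i,x)$ with $x \in \mathbf{x}$. Let $g(\boldsymbol{a}_0)$, $h(\boldsymbol{b}_i)$, $f(\boldsymbol{v}_i)$ be given real data vectors of the matching lengths (values of the initial datum, boundary datum and right-hand side of a PDE). $U$ is a Gaussian process on $E$ with mean function $\mu$ and covariance function $\Sigma$. For each $i \in \{0,\dots,n-1\}$, $D_i$ is a given linear operator acting on real-valued functions on $E$ (a linear approximation to a nonlinear differential operator). Notation. For a function $\phi$ on $E$ and a linear operator $L$, $\phi_L = L\phi$. For a bivariate function $\Sigma(r,s)$, $\Sigma_L(r,s) = L_r\Sigma(r,s)$ ($L$ acting on the first argument), $\Sigma_{\bar L}(r,s) = L_s\Sigma(r,s)$ ($L$ acting on the second argument), and $\Sigma_{L \bar L'} = (\Sigma_L)_{\bar L'}$. Functions evaluated at lists of points denote the corresponding vectors or matrices; e.g. $\Sigma(r,\boldsymbol{b})$ is a row vector, $\Sigma(\boldsymbol{b},s)$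 a column vector, $\Sigma(\boldsymbol{b},\boldsymbol{v})$ a matrix. It is assumed that $\mu,\Sigma$ are regular enough that all the quantities below are well defined, that operators acting on the first argument commute with operators acting on the second argument, so that in particular $\mathrm{Cov}(D_iU(r),U(s)) = \Sigma_{D_i}(r,s)$ and $\mathrm{Cov}(D_iU(r),D_jU(s)) = \Sigma_{D_i\bar D_j}(r,s)$, and that the matrices being inverted are invertible. Sequential procedure. $U^0 \sim \mathcal{GP}(\mu^0,\Sigma^0)$ with $$\mu^0(r) = \mu(r) + \Sigma(r,\boldsymbol{a}_0)\Sigma(\boldsymbol{a}_0,\boldsymbol{a}_0)^{-1}(g(\boldsymbol{a}_0) - \mu(\boldsymbol{a}_0)),$$ $$\Sigma^0(r,s) = \Sigma(r,s) - \Sigma(r,\boldsymbol{a}_0)\Sigma(\boldsymbol{a}_0,\boldsymbol{a}_0)^{-1}\Sigma(\boldsymbol{a}_0,s),$$ and for $i = 0,\dots,n-1$, $U^{i+1} \sim \mathcal{GP}(\mu^{i+1},\Sigma^{i+1})$ with $$\mu^{i+1}(r) = \mu^i(r) + [\Sigma^i(r,\boldsymbol{b}_i), \Sigma^i_{\bar D_i}(r,\boldsymbol{v}_i)] A_i^{-1} \begin{bmatrix} h(\boldsymbol{b}_i) - \mu^i(\boldsymbol{b}_i) \\ f(\boldsymbol{v}_i) - \mu^i_{D_i}(\boldsymbol{v}_i) \end{bmatrix},$$ $$\Sigma^{i+1}(r,s) = \Sigma^i(r,s) - [\Sigma^i(r,\boldsymbol{b}_i), \Sigma^i_{\bar D_i}(r,\boldsymbol{v}_i)]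 A_i^{-1} \begin{bmatrix} \Sigma^i(\boldsymbol{b}_i,s) \\ \Sigma^i_{D_i}(\boldsymbol{v}_i,s) \end{bmatrix},$$ $$A_i = \begin{bmatrix} \Sigma^i(\boldsymbol{b}_i,\boldsymbol{b}_i) & \Sigma^i_{\bar D_i}(\boldsymbol{b}_i,\boldsymbol{v}_i) \\ \Sigma^i_{D_i}(\boldsymbol{v}_i,\boldsymbol{b}_i) & \Sigma^i_{D_i\bar D_i}(\boldsymbol{v}_i,\boldsymbol{v}_i) \end{bmatrix}.$$ All-at-once conditioning. If $Y$ is a finite vector of (jointly Gaussian) linear functionals of $U$ with mean vector $m_Y$, covariance matrix $M = \mathrm{Cov}(Y,Y)$ (invertible) and cross-covariance row vector $L(r) = \mathrm{Cov}(U(r),Y)$, then $U$ conditioned on $Y = y$ is the Gaussian process with mean $r \mapsto \mu(r) + L(r)M^{-1}(y - m_Y)$ and covariance $(r,s) \mapsto \Sigma(r,s) - L(r)M^{-1}L(s)^\top$. *)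

theory Defs
  imports "HOL-Probability.Probability" "Jordan_Normal_Form.Gauss_Jordan_Elimination"
begin

text \<open>Constant random variables count as (degenerate) Gaussian ones.\<close>

definition gaussian_rv :: "'w measure \<Rightarrow> ('w \<Rightarrow> real) \<Rightarrow> bool" where
  "gaussian_rv M Z \<longleftrightarrow> Z \<in> borel_measurable M \<and>
     ((\<exists>m. AE w in M. Z w = m) \<or>
      (\<exists>m \<sigma>. \<sigma> > 0 \<and> distributed M lborel Z (\<lambda>x. ennreal (normal_density m \<sigma> x))))"

definition gaussian_family :: "'w measure \<Rightarrow> 'i set \<Rightarrow> ('i \<Rightarrow> 'w \<Rightarrow> real) \<Rightarrow> bool" where
  "gaussian_family M I X \<longleftrightarrow>
     (\<forall>J c. finite J \<longrightarrow> J \<subseteq> I \<longrightarrow> gaussian_rv M (\<lambda>w. \<Sum>i\<in>J. c i * X i w))"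

definition mean :: "'w measure \<Rightarrow> ('w \<Rightarrow> real) \<Rightarrow> real" where
  "mean M X = (LINT w|M. X w)"

definition cov :: "'w measure \<Rightarrow> ('w \<Rightarrow> real) \<Rightarrow> ('w \<Rightarrow> real) \<Rightarrow> real" where
  "cov M X Y = (LINT w|M. (X w - mean M X) * (Y w - mean M Y))"

definition gaussian_process ::
  "'w measure \<Rightarrow> 'p set \<Rightarrow> ('p \<Rightarrow> 'w \<Rightarrow> real) \<Rightarrow> ('p \<Rightarrow> real) \<Rightarrow> ('p \<Rightarrow> 'p \<Rightarrow> real) \<Rightarrow> bool" where
  "gaussian_process M E U \<mu> K \<longleftrightarrow>
     prob_space M \<and> gaussian_family M E U \<and>
     (\<forall>r\<in>E. mean M (U r) = \<mu> r) \<and> (\<forall>r\<in>E. \<forall>s\<in>E. cov M (U r) (U s) = K r s)"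

text \<open>
  Real functions on \<open>E\<close> are represented by total functions, of which only the values on \<open>E\<close>
  are relevant: both the operator \<open>L\<close> and its domain \<open>W\<close> (a linear space of functions, e.g. the
  sufficiently smooth ones) respect equality on \<open>E\<close>.
\<close>

definition linear_operator_on ::
  "'p set \<Rightarrow> ('p \<Rightarrow> real) set \<Rightarrow> (('p \<Rightarrow> real) \<Rightarrow> ('p \<Rightarrow> real)) \<Rightarrow> bool" where
  "linear_operator_on E W L \<longleftrightarrow>
     (\<lambda>_. 0) \<in> W \<and>
     (\<forall>\<phi>\<in>W. \<forall>\<psi>\<in>W. (\<lambda>r. \<phi> r + \<psi> r) \<in> W \<and>
        (\<forall>r\<in>E. L (\<lambda>r. \<phi> r + \<psi> r) r = L \<phi> r + L \<psi> r)) \<and>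
     (\<forall>c. \<forall>\<phi>\<in>W. (\<lambda>r. c * \<phi> r) \<in> W \<and> (\<forall>r\<in>E. L (\<lambda>r. c * \<phi> r) r = c * L \<phi> r)) \<and>
     (\<forall>\<phi>\<in>W. \<forall>\<psi>. (\<forall>r\<in>E. \<psi> r = \<phi> r) \<longrightarrow> \<psi> \<in> W \<and> (\<forall>r\<in>E. L \<psi> r = L \<phi> r))"

definition apply1 ::
  "(('p \<Rightarrow> real) \<Rightarrow> ('p \<Rightarrow> real)) \<Rightarrow> ('p \<Rightarrow> 'p \<Rightarrow> real) \<Rightarrow> 'p \<Rightarrow> 'p \<Rightarrow> real" where
  "apply1 L K r s = L (\<lambda>r'. K r' s) r"

definition apply2 ::
  "(('p \<Rightarrow> real) \<Rightarrow> ('p \<Rightarrow> real)) \<Rightarrow> ('p \<Rightarrow> 'p \<Rightarrow> real) \<Rightarrow> 'p \<Rightarrow> 'p \<Rightarrow> real" where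
  "apply2 L K r s = L (\<lambda>s'. K r s') s"

definition apply_process ::
  "(('p \<Rightarrow> real) \<Rightarrow> ('p \<Rightarrow> real)) \<Rightarrow> ('p \<Rightarrow> 'w \<Rightarrow> real) \<Rightarrow> 'p \<Rightarrow> 'w \<Rightarrow> real" where
  "apply_process L U r w = L (\<lambda>r'. U r' w) r"

definition eval_vec :: "('p \<Rightarrow> real) \<Rightarrow> 'p list \<Rightarrow> real Matrix.vec" where
  "eval_vec \<phi> ps = vec_of_list (map \<phi> ps)"

definition eval_mat :: "('p \<Rightarrow> 'q \<Rightarrow> real) \<Rightarrow> 'p list \<Rightarrow> 'q list \<Rightarrow> real Matrix.mat" where
  "eval_mat K ps qs = Matrix.mat (length ps) (length qs) (\<lambda>(i, j). K (ps ! i) (qs ! j))"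

text \<open>Only meaningful for invertible matrices.\<close>

definition minv :: "real Matrix.mat \<Rightarrow> real Matrix.mat" where
  "minv A = the (mat_inverse A)"

definition init_mean ::
  "('p \<Rightarrow> real) \<Rightarrow> ('p \<Rightarrow> 'p \<Rightarrow> real) \<Rightarrow> 'p list \<Rightarrow> ('p \<Rightarrow> real) \<Rightarrow> 'p \<Rightarrow> real" where
  "init_mean \<mu> K a g r =
     \<mu> r + scalar_prod (eval_vec (K r) a) (minv (eval_mat K a a) *\<^sub>v (eval_vec g a - eval_vec \<mu> a))"

definition init_cov ::
  "('p \<Rightarrow> 'p \<Rightarrow> real) \<Rightarrow> 'p list \<Rightarrow> 'p \<Rightarrow> 'p \<Rightarrow> real" where
  "init_cov K a r s =
     K r s - scalar_prod (eval_vec (K r) a) (minv (eval_mat K a a) *\<^sub>v eval_vec (\<lambda>p. K p s) a)"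

definition step_mat ::
  "('p \<Rightarrow> 'p \<Rightarrow> real) \<Rightarrow> (('p \<Rightarrow> real) \<Rightarrow> ('p \<Rightarrow> real)) \<Rightarrow> 'p list \<Rightarrow> 'p list \<Rightarrow> real Matrix.mat" where
  "step_mat K L b v =
     four_block_mat (eval_mat K b b)            (eval_mat (apply2 L K) b v)
                    (eval_mat (apply1 L K) v b) (eval_mat (apply2 L (apply1 L K)) v v)"

definition step_row ::
  "('p \<Rightarrow> 'p \<Rightarrow> real) \<Rightarrow> (('p \<Rightarrow> real) \<Rightarrow> ('p \<Rightarrow> real)) \<Rightarrow> 'p list \<Rightarrow> 'p list \<Rightarrow> 'p \<Rightarrow> real Matrix.vec" where
  "step_row K L b v r = eval_vec (K r) b @\<^sub>v eval_vec (apply2 L K r) v"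

definition step_col ::
  "('p \<Rightarrow> 'p \<Rightarrow> real) \<Rightarrow> (('p \<Rightarrow> real) \<Rightarrow> ('p \<Rightarrow> real)) \<Rightarrow> 'p list \<Rightarrow> 'p list \<Rightarrow> 'p \<Rightarrow> real Matrix.vec" where
  "step_col K L b v s = eval_vec (\<lambda>p. K p s) b @\<^sub>v eval_vec (\<lambda>p. apply1 L K p s) v"

definition step_mean ::
  "('p \<Rightarrow> real) \<Rightarrow> ('p \<Rightarrow> 'p \<Rightarrow> real) \<Rightarrow> (('p \<Rightarrow> real) \<Rightarrow> ('p \<Rightarrow> real)) \<Rightarrow> 'p list \<Rightarrow> 'p list \<Rightarrow>
   ('p \<Rightarrow> real) \<Rightarrow> ('p \<Rightarrow> real) \<Rightarrow> 'p \<Rightarrow> real" where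
  "step_mean \<mu> K L b v h f r =
     \<mu> r + scalar_prod (step_row K L b v r)
             (minv (step_mat K L b v) *\<^sub>v
               ((eval_vec h b - eval_vec \<mu> b) @\<^sub>v (eval_vec f v - eval_vec (L \<mu>) v)))"

definition step_cov ::
  "('p \<Rightarrow> 'p \<Rightarrow> real) \<Rightarrow> (('p \<Rightarrow> real) \<Rightarrow> ('p \<Rightarrow> real)) \<Rightarrow> 'p list \<Rightarrow> 'p list \<Rightarrow> 'p \<Rightarrow> 'p \<Rightarrow> real" where
  "step_cov K L b v r s =
     K r s - scalar_prod (step_row K L b v r) (minv (step_mat K L b v) *\<^sub>v step_col K L b v s)"

primrec seq_cov ::
  "('p \<Rightarrow> 'p \<Rightarrow> real) \<Rightarrow> (nat \<Rightarrow> ('p \<Rightarrow> real) \<Rightarrow> ('p \<Rightarrow> real)) \<Rightarrow>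
   'p list \<Rightarrow> (nat \<Rightarrow> 'p list) \<Rightarrow> (nat \<Rightarrow> 'p list) \<Rightarrow> nat \<Rightarrow> 'p \<Rightarrow> 'p \<Rightarrow> real" where
  "seq_cov K D a b v 0 = init_cov K a"
| "seq_cov K D a b v (Suc i) = step_cov (seq_cov K D a b v i) (D i) (b i) (v i)"

primrec seq_mean ::
  "('p \<Rightarrow> real) \<Rightarrow> ('p \<Rightarrow> 'p \<Rightarrow> real) \<Rightarrow> (nat \<Rightarrow> ('p \<Rightarrow> real) \<Rightarrow> ('p \<Rightarrow> real)) \<Rightarrow>
   'p list \<Rightarrow> (nat \<Rightarrow> 'p list) \<Rightarrow> (nat \<Rightarrow> 'p list) \<Rightarrow>
   ('p \<Rightarrow> real) \<Rightarrow> ('p \<Rightarrow> real) \<Rightarrow> ('p \<Rightarrow> real) \<Rightarrow> nat \<Rightarrow> 'p \<Rightarrow> real" where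
  "seq_mean \<mu> K D a b v g h f 0 = init_mean \<mu> K a g"
| "seq_mean \<mu> K D a b v g h f (Suc i) =
     step_mean (seq_mean \<mu> K D a b v g h f i) (seq_cov K D a b v i) (D i) (b i) (v i) h f"

definition obs_mean :: "'w measure \<Rightarrow> ('w \<Rightarrow> real) list \<Rightarrow> real Matrix.vec" where
  "obs_mean M Ys = eval_vec (mean M) Ys"

definition obs_cov :: "'w measure \<Rightarrow> ('w \<Rightarrow> real) list \<Rightarrow> real Matrix.mat" where
  "obs_cov M Ys = eval_mat (cov M) Ys Ys"

definition cross_cov ::
  "'w measure \<Rightarrow> ('p \<Rightarrow> 'w \<Rightarrow> real) \<Rightarrow> ('w \<Rightarrow> real) list \<Rightarrow> 'p \<Rightarrow> real Matrix.vec" where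
  "cross_cov M U Ys r = eval_vec (cov M (U r)) Ys"

definition cond_mean ::
  "'w measure \<Rightarrow> ('p \<Rightarrow> 'w \<Rightarrow> real) \<Rightarrow> ('p \<Rightarrow> real) \<Rightarrow>
   ('w \<Rightarrow> real) list \<Rightarrow> real Matrix.vec \<Rightarrow> 'p \<Rightarrow> real" where
  "cond_mean M U \<mu> Ys y r =
     \<mu> r + scalar_prod (cross_cov M U Ys r) (minv (obs_cov M Ys) *\<^sub>v (y - obs_mean M Ys))"

definition cond_cov ::
  "'w measure \<Rightarrow> ('p \<Rightarrow> 'w \<Rightarrow> real) \<Rightarrow> ('p \<Rightarrow> 'p \<Rightarrow> real) \<Rightarrow>
   ('w \<Rightarrow> real) list \<Rightarrow> 'p \<Rightarrow> 'p \<Rightarrow> real" where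
  "cond_cov M U K Ys r s =
     K r s - scalar_prod (cross_cov M U Ys r) (minv (obs_cov M Ys) *\<^sub>v cross_cov M U Ys s)"

text \<open>
  The stacked list \<open>[F(a), G(b\<^sub>0), H\<^sub>0(v\<^sub>0), \<dots>, G(b\<^sub>n\<^sub>-\<^sub>1), H\<^sub>n\<^sub>-\<^sub>1(v\<^sub>n\<^sub>-\<^sub>1)]\<close>, used both for the
  observed random variables and for the observed values.
\<close>

definition stack ::
  "nat \<Rightarrow> 'p list \<Rightarrow> (nat \<Rightarrow> 'p list) \<Rightarrow> (nat \<Rightarrow> 'p list) \<Rightarrow>
   ('p \<Rightarrow> 'b) \<Rightarrow> ('p \<Rightarrow> 'b) \<Rightarrow> (nat \<Rightarrow> 'p \<Rightarrow> 'b) \<Rightarrow> 'b list" where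
  "stack n a b v F G H = map F a @ concat (map (\<lambda>i. map G (b i) @ map (H i) (v i)) [0..<n])"

end

theory Submission
  imports Defs "Jordan_Normal_Form.Determinant"
begin

text \<open>
  All covariances involved are values of one kernel, \<open>cov M\<close>, on the random variables \<open>U r\<close> and
  \<open>D\<^sub>i U r\<close>. For an arbitrary kernel \<open>K\<close>, conditioning on \<open>ys\<close> and then on \<open>zs\<close> equals conditioning
  on \<open>ys @ zs\<close>: block elimination with the Schur complement, which is the matrix of the kernel
  conditioned on \<open>ys\<close> at \<open>zs\<close>. The sequential procedure works with functions on \<open>E\<close> instead, to
  which \<open>D\<^sub>i\<close> is applied. The conditioned means and covariances are finite linear combinations of
  \<open>\<mu>\<close>, \<open>\<Sigma>\<close> and derived kernels, so by linearity applying \<open>D\<^sub>i\<close> to them amounts to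
  replacing the argument \<open>U r\<close> by \<open>D\<^sub>i U r\<close>, and each step is a conditioning step of the kernel.
\<close>

section \<open>Evaluation at lists and matrix inverses\<close>

lemma eval_vec_carrier [simp]: "eval_vec \<phi> ps \<in> carrier_vec (length ps)"
  by (simp add: eval_vec_def carrier_dim_vec)

lemma dim_eval_vec [simp]: "dim_vec (eval_vec \<phi> ps) = length ps"
  by (simp add: eval_vec_def)

lemma index_eval_vec [simp]: "i < length ps \<Longrightarrow> eval_vec \<phi> ps $ i = \<phi> (ps ! i)"
  unfolding eval_vec_def by (subst index_vec_of_list) simp_all

lemma eval_mat_carrier [simp]: "eval_mat K ps qs \<in> carrier_mat (length ps) (length qs)"
  by (simp add: eval_mat_def)

lemma dim_eval_mat [simp]:
  "dim_row (eval_mat K ps qs) = length ps" "dim_col (eval_mat K ps qs) = length qs"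
  by (simp_all add: eval_mat_def)

lemma row_eval_mat [simp]: "i < length ps \<Longrightarrow> row (eval_mat K ps qs) i = eval_vec (K (ps ! i)) qs"
  by (rule eq_vecI) (simp_all add: eval_mat_def)

lemma col_eval_mat [simp]: "j < length qs \<Longrightarrow> col (eval_mat K ps qs) j = eval_vec (\<lambda>p. K p (qs ! j)) ps"
  by (rule eq_vecI) (simp_all add: eval_mat_def)

lemma eval_vec_append: "eval_vec \<phi> (ps @ qs) = eval_vec \<phi> ps @\<^sub>v eval_vec \<phi> qs"
  by (rule eq_vecI) (auto simp: nth_append)

lemma vec_of_list_append: "vec_of_list (xs @ ys) = vec_of_list xs @\<^sub>v vec_of_list ys"
  by (rule eq_vecI) (auto simp: index_vec_of_list nth_append)

lemma zero_vec_append: "0\<^sub>v (p + q) = 0\<^sub>v p @\<^sub>v 0\<^sub>v q"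
  by (rule eq_vecI) auto

lemma mult_mat_vec_zero: "(A :: real Matrix.mat) \<in> carrier_mat p q \<Longrightarrow> A *\<^sub>v 0\<^sub>v q = 0\<^sub>v p"
  by (rule eq_vecI) auto

section \<open>Inverses of square matrices and the linear systems they solve\<close>

lemma invertible_mat_minv:
  assumes A: "A \<in> carrier_mat n n" and inv: "invertible_mat A"
  shows "minv A \<in> carrier_mat n n" "A * minv A = 1\<^sub>m n" "minv A * A = 1\<^sub>m n"
proof -
  obtain B where AB: "A * B = 1\<^sub>m (dim_row A)" and BA: "B * A = 1\<^sub>m (dim_row B)"
    using inv unfolding invertible_mat_def inverts_mat_def by blast
  \<comment> \<open>The witness \<open>B\<close> comes without dimensions. Comparing column counts
    in \<open>AB\<close> and \<open>BA\<close> forces it to be square of size \<open>n\<close>, so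
    that \<open>A\<close> is a unit of the matrix ring and \<open>mat_inverse\<close> cannot return
    \<open>None\<close>.\<close>
  have "dim_col B = n" using arg_cong[OF AB, of dim_col] A by simp
  moreover have "dim_row B = n" using arg_cong[OF BA, of dim_col] A by simp
  ultimately have "A \<in> Units (ring_mat TYPE(real) n ())"
    using A AB BA unfolding Units_def ring_mat_def by auto
  then obtain C where "mat_inverse A = Some C"
    using mat_inverse(1)[OF A, of "()"] by (cases "mat_inverse A") auto
  then show "minv A \<in> carrier_mat n n" "A * minv A = 1\<^sub>m n" "minv A * A = 1\<^sub>m n"
    using mat_inverse(2)[OF A, of C] by (auto simp: minv_def)
qed

lemma invertible_mat_solve:
  assumes A: "A \<in> carrier_mat n n" and inv: "invertible_mat A" and d: "d \<in> carrier_vec n"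
  shows "minv A *\<^sub>v d \<in> carrier_vec n" "A *\<^sub>v (minv A *\<^sub>v d) = d" "minv A *\<^sub>v (A *\<^sub>v d) = d"
proof -
  note B = invertible_mat_minv[OF A inv]
  show "minv A *\<^sub>v d \<in> carrier_vec n" using B(1) d by simp
  show "A *\<^sub>v (minv A *\<^sub>v d) = d" "minv A *\<^sub>v (A *\<^sub>v d) = d"
    using assoc_mult_mat_vec[OF A B(1) d] assoc_mult_mat_vec[OF B(1) A d] B d by simp_all
qed

text \<open>A singular matrix would have a nonzero kernel vector, so the determinant is nonzero.
  This lets invertibility of a block matrix be checked on a homogeneous system.\<close>

lemma invertible_mat_if_trivial_kernel:
  fixes A :: "real Matrix.mat"
  assumes A: "A \<in> carrier_mat n n"
    and ker: "\<And>w. w \<in> carrier_vec n \<Longrightarrow> A *\<^sub>v w = 0\<^sub>v n \<Longrightarrow> w = 0\<^sub>v n"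
  shows "invertible_mat A"
proof -
  have "Determinant.det A \<noteq> 0" using det_0_iff_vec_prod_zero[OF A] ker by blast
  from det_non_zero_imp_unit[OF A this, of "()"] show ?thesis
    using A unfolding Units_def ring_mat_def invertible_mat_def inverts_mat_def by auto
qed

section \<open>Iterated conditioning for an abstract kernel\<close>

text \<open>The Gaussian conditioning formula over an arbitrary index type. With random variables as
  indices, \<open>X\<close> may be a value of the process or of its image under an operator.\<close>

definition post_mean ::
  "('a \<Rightarrow> real) \<Rightarrow> ('a \<Rightarrow> 'a \<Rightarrow> real) \<Rightarrow> 'a list \<Rightarrow> real Matrix.vec \<Rightarrow> 'a \<Rightarrow> real" where
  "post_mean m K ys y X =
     m X + scalar_prod (eval_vec (K X) ys) (minv (eval_mat K ys ys) *\<^sub>v (y - eval_vec m ys))"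

definition post_cov :: "('a \<Rightarrow> 'a \<Rightarrow> real) \<Rightarrow> 'a list \<Rightarrow> 'a \<Rightarrow> 'a \<Rightarrow> real" where
  "post_cov K ys X Z =
     K X Z - scalar_prod (eval_vec (K X) ys) (minv (eval_mat K ys ys) *\<^sub>v eval_vec (\<lambda>p. K p Z) ys)"

text \<open>Reduces statements about covariances to means: condition the mean function \<open>K(\<cdot>, Z)\<close> on data \<open>0\<close>.\<close>

lemma post_cov_eq_post_mean:
  assumes "invertible_mat (eval_mat K ys ys)"
  shows "post_cov K ys X Z = post_mean (\<lambda>p. K p Z) K ys (0\<^sub>v (length ys)) X"
proof -
  let ?A = "minv (eval_mat K ys ys)" and ?e = "eval_vec (\<lambda>p. K p Z) ys"
  have A: "?A \<in> carrier_mat (length ys) (length ys)"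
    using invertible_mat_minv[OF eval_mat_carrier assms] by blast
  have "?A *\<^sub>v (0\<^sub>v (length ys) - ?e) = - (?A *\<^sub>v ?e)"
  proof -
    have "0\<^sub>v (length ys) - ?e = - ?e" by (rule eq_vecI) simp_all
    then show ?thesis using A by (intro eq_vecI) simp_all
  qed
  then show ?thesis using A
    unfolding post_cov_def post_mean_def by (simp add: minus_scalar_prod_distrib)
qed

text \<open>The weight vector is the unique solution of the linear system, so any solution
  \<open>w\<close> may be used. The inverse of a stacked matrix thus never has to be
  computed.\<close>

lemma post_mean_eqI:
  assumes "invertible_mat (eval_mat K ys ys)" and "w \<in> carrier_vec (length ys)"
    and "eval_mat K ys ys *\<^sub>v w = y - eval_vec m ys"
  shows "post_mean m K ys y X = m X + scalar_prod (eval_vec (K X) ys) w"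
  unfolding post_mean_def assms(3)[symmetric]
  by (simp add: invertible_mat_solve(3)[OF eval_mat_carrier assms(1,2)])

lemma scalar_prod_mult_mat_vec_swap:
  assumes "(A :: real Matrix.mat) \<in> carrier_mat n n" and "c \<in> carrier_vec n" and "d \<in> carrier_vec n"
  shows "scalar_prod c (A *\<^sub>v d) = scalar_prod d (transpose_mat A *\<^sub>v c)"
  using transpose_vec_mult_scalar[OF assms(1,3,2)]
    comm_scalar_prod[OF assms(3) mult_mat_vec_carrier[OF transpose_carrier_mat[THEN iffD2, OF assms(1)] assms(2)]]
  by simp

text \<open>Every entry of the updated row subtracts a product with the same vector
  \<open>c\<close>. Combining the entries with weights \<open>u\<close> therefore moves
  \<open>u\<close> inside, next to the cross block.\<close>

lemma post_cov_scalar_prod: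
  assumes inv: "invertible_mat (eval_mat K ys ys)" and u: "u \<in> carrier_vec (length zs)"
  shows "scalar_prod (eval_vec (post_cov K ys X) zs) u =
    scalar_prod (eval_vec (K X) zs) u -
    scalar_prod (eval_vec (K X) ys) (minv (eval_mat K ys ys) *\<^sub>v (eval_mat K ys zs *\<^sub>v u))"
proof -
  let ?A = "minv (eval_mat K ys ys)" and ?B = "eval_mat K ys zs" and ?k = "eval_vec (K X) ys"
  note A = invertible_mat_minv(1)[OF eval_mat_carrier inv]
  \<comment> \<open>Transposing the inverse moves it onto the row at \<open>X\<close>, which does
    not depend on the entry of \<open>zs\<close>.\<close>
  define c where "c = transpose_mat ?A *\<^sub>v ?k"
  have c: "c \<in> carrier_vec (length ys)" using A by (simp add: c_def)
  have move: "scalar_prod ?k (?A *\<^sub>v d) = scalar_prod c d" if "d \<in> carrier_vec (length ys)" for d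
    unfolding c_def using transpose_vec_mult_scalar[OF A that, of ?k] by simp
  have "eval_vec (post_cov K ys X) zs = eval_vec (K X) zs - transpose_mat ?B *\<^sub>v c"
    using c by (intro eq_vecI) (simp_all add: post_cov_def move comm_scalar_prod[of _ "length ys"])
  also have "scalar_prod \<dots> u = scalar_prod (eval_vec (K X) zs) u - scalar_prod (transpose_mat ?B *\<^sub>v c) u"
    by (rule minus_scalar_prod_distrib[OF eval_vec_carrier _ u])
      (rule mult_mat_vec_carrier[OF transpose_carrier_mat[THEN iffD2, OF eval_mat_carrier] c])
  also have "scalar_prod (transpose_mat ?B *\<^sub>v c) u = scalar_prod c (?B *\<^sub>v u)"
    using transpose_vec_mult_scalar[OF eval_mat_carrier u c] .
  also have "\<dots> = scalar_prod ?k (?A *\<^sub>v (?B *\<^sub>v u))"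
    by (rule move[OF mult_mat_vec_carrier[OF eval_mat_carrier u], symmetric])
  finally show ?thesis .
qed

section \<open>Schur complements and conditioning on concatenated data\<close>

lemma eval_mat_append:
  "eval_mat K (ps @ qs) (rs @ ss) =
    four_block_mat (eval_mat K ps rs) (eval_mat K ps ss) (eval_mat K qs rs) (eval_mat K qs ss)"
  by (rule eq_matI) (auto simp: eval_mat_def nth_append)

lemma eval_mat_append_mult_vec:
  assumes "w \<in> carrier_vec (length rs)" and "u \<in> carrier_vec (length ss)"
  shows "eval_mat K (ps @ qs) (rs @ ss) *\<^sub>v (w @\<^sub>v u) =
    (eval_mat K ps rs *\<^sub>v w + eval_mat K ps ss *\<^sub>v u) @\<^sub>v
    (eval_mat K qs rs *\<^sub>v w + eval_mat K qs ss *\<^sub>v u)"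
  unfolding eval_mat_append
  by (rule four_block_mat_mult_vec[OF eval_mat_carrier eval_mat_carrier eval_mat_carrier eval_mat_carrier assms])

text \<open>This is \<open>post_cov_scalar_prod\<close> row by row. For \<open>xs = zs\<close> the
  right-hand side is the Schur complement of the \<open>ys\<close> block, applied to
  \<open>u\<close>.\<close>

lemma eval_mat_post_cov_mult_vec:
  assumes inv: "invertible_mat (eval_mat K ys ys)" and u: "u \<in> carrier_vec (length zs)"
  shows "eval_mat (post_cov K ys) xs zs *\<^sub>v u =
    eval_mat K xs zs *\<^sub>v u -
    eval_mat K xs ys *\<^sub>v (minv (eval_mat K ys ys) *\<^sub>v (eval_mat K ys zs *\<^sub>v u))"
  by (rule eq_vecI) (simp_all add: post_cov_scalar_prod[OF inv u])

text \<open>Block elimination on a kernel vector \<open>w1 @\<^sub>v u\<close>: the top rows express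
  \<open>w1\<close> through \<open>u\<close>, whereupon the bottom rows say that the Schur
  complement annihilates \<open>u\<close>. Hence \<open>u\<close> vanishes, and with it
  \<open>w1\<close>.\<close>

lemma invertible_eval_mat_append:
  assumes inv: "invertible_mat (eval_mat K ys ys)"
    and inv': "invertible_mat (eval_mat (post_cov K ys) zs zs)"
  shows "invertible_mat (eval_mat K (ys @ zs) (ys @ zs))"
proof (rule invertible_mat_if_trivial_kernel)
  show "eval_mat K (ys @ zs) (ys @ zs) \<in> carrier_mat (length ys + length zs) (length ys + length zs)"
    using eval_mat_carrier[of K "ys @ zs" "ys @ zs"] by simp
next
  let ?p = "length ys" and ?q = "length zs"
  let ?S = "eval_mat K ys ys" and ?B = "eval_mat K ys zs" and ?B' = "eval_mat K zs ys"
    and ?D = "eval_mat K zs zs" and ?C = "eval_mat (post_cov K ys) zs zs"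
  fix w assume w_carrier: "w \<in> carrier_vec (?p + ?q)"
    and 0: "eval_mat K (ys @ zs) (ys @ zs) *\<^sub>v w = 0\<^sub>v (?p + ?q)"
  obtain w1 u where w: "w = w1 @\<^sub>v u" and w1: "w1 \<in> carrier_vec ?p" and u: "u \<in> carrier_vec ?q"
    by (rule that[OF vec_first_last_append[OF w_carrier, symmetric] vec_first_carrier vec_last_carrier])
  \<comment> \<open>The candidate for \<open>- w1\<close>: with \<open>?S *\<^sub>v x\<close> equal
    to \<open>?B *\<^sub>v u\<close>, the top rows say that \<open>?S\<close> annihilates
    \<open>w1 + x\<close>.\<close>
  define x where "x = minv ?S *\<^sub>v (?B *\<^sub>v u)"
  note Bu = mult_mat_vec_carrier[OF eval_mat_carrier u, of K ys]
  have x: "x \<in> carrier_vec ?p" and Sx: "?S *\<^sub>v x = ?B *\<^sub>v u"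
    using invertible_mat_solve[OF eval_mat_carrier inv Bu] by (simp_all add: x_def)
  have "(?S *\<^sub>v w1 + ?B *\<^sub>v u) @\<^sub>v (?B' *\<^sub>v w1 + ?D *\<^sub>v u) = 0\<^sub>v ?p @\<^sub>v 0\<^sub>v ?q"
    using 0 unfolding w eval_mat_append_mult_vec[OF w1 u] zero_vec_append .
  moreover have "?S *\<^sub>v w1 + ?B *\<^sub>v u \<in> carrier_vec ?p"
    by (rule add_carrier_vec[OF mult_mat_vec_carrier[OF eval_mat_carrier w1] Bu])
  ultimately have top: "?S *\<^sub>v w1 + ?B *\<^sub>v u = 0\<^sub>v ?p" and bot: "?B' *\<^sub>v w1 + ?D *\<^sub>v u = 0\<^sub>v ?q"
    using append_vec_eq[of "?S *\<^sub>v w1 + ?B *\<^sub>v u" ?p "0\<^sub>v ?p"] by simp_all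
  have "?S *\<^sub>v (w1 + x) = 0\<^sub>v ?p"
    unfolding mult_add_distrib_mat_vec[OF eval_mat_carrier w1 x] Sx by (rule top)
  then have "w1 + x = minv ?S *\<^sub>v 0\<^sub>v ?p"
    using invertible_mat_solve(3)[OF eval_mat_carrier inv add_carrier_vec[OF w1 x]] by simp
  then have w1x: "w1 + x = 0\<^sub>v ?p"
    using mult_mat_vec_zero[OF invertible_mat_minv(1)[OF eval_mat_carrier inv]] by simp
  \<comment> \<open>Allows \<open>?B' *\<^sub>v w1\<close> in the bottom rows to be traded for
    \<open>- (?B' *\<^sub>v x)\<close>, which produces the Schur complement.\<close>
  have "?B' *\<^sub>v w1 + ?B' *\<^sub>v x = 0\<^sub>v ?q"
    unfolding mult_add_distrib_mat_vec[OF eval_mat_carrier w1 x, symmetric] w1x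
    by (rule mult_mat_vec_zero[OF eval_mat_carrier])
  have "?C *\<^sub>v u = 0\<^sub>v ?q"
  proof (rule eq_vecI)
    fix i assume "i < dim_vec (0\<^sub>v ?q :: real Matrix.vec)"
    then have i: "i < ?q" by simp
    show "vec_index (?C *\<^sub>v u) i = vec_index (0\<^sub>v ?q) i"
      unfolding eval_mat_post_cov_mult_vec[OF inv u] x_def[symmetric]
      using arg_cong[OF bot, of "\<lambda>z. vec_index z i"]
        arg_cong[OF \<open>?B' *\<^sub>v w1 + ?B' *\<^sub>v x = 0\<^sub>v ?q\<close>, of "\<lambda>z. vec_index z i"] i by simp
  qed simp
  then have u0: "u = 0\<^sub>v ?q"
    using invertible_mat_solve(3)[OF eval_mat_carrier inv' u]
      mult_mat_vec_zero[OF invertible_mat_minv(1)[OF eval_mat_carrier inv']] by simp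
  have "x = 0\<^sub>v ?p"
    unfolding x_def u0 mult_mat_vec_zero[OF eval_mat_carrier]
    by (rule mult_mat_vec_zero[OF invertible_mat_minv(1)[OF eval_mat_carrier inv]])
  then have "w1 = 0\<^sub>v ?p" using w1x w1 by simp
  then show "w = 0\<^sub>v (?p + ?q)" unfolding w u0 zero_vec_append by simp
qed

text \<open>The two stages supply an explicit solution of the stacked system. The first stage has
  weights \<open>x0\<close> and the second has weights \<open>u\<close>; the block on
  \<open>ys\<close> is then corrected by \<open>x\<close>, so that
  \<open>(x0 - x) @\<^sub>v u\<close> satisfies the hypotheses of
  \<open>post_mean_eqI\<close>.\<close>

lemma post_mean_append:
  assumes inv: "invertible_mat (eval_mat K ys ys)"
    and inv': "invertible_mat (eval_mat (post_cov K ys) zs zs)"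
    and y: "y \<in> carrier_vec (length ys)" and z: "z \<in> carrier_vec (length zs)"
  shows "post_mean (post_mean m K ys y) (post_cov K ys) zs z X = post_mean m K (ys @ zs) (y @\<^sub>v z) X"
proof -
  let ?S = "eval_mat K ys ys" and ?B = "eval_mat K ys zs" and ?B' = "eval_mat K zs ys"
    and ?D = "eval_mat K zs zs" and ?C = "eval_mat (post_cov K ys) zs zs"
  let ?m = "post_mean m K ys y"
  define d where "d = y - eval_vec m ys"
  define x0 where "x0 = minv ?S *\<^sub>v d"
  define u where "u = minv ?C *\<^sub>v (z - eval_vec ?m zs)"
  define x where "x = minv ?S *\<^sub>v (?B *\<^sub>v u)"
  have d: "d \<in> carrier_vec (length ys)"
    unfolding d_def by (rule minus_carrier_vec[OF y eval_vec_carrier])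
  have dz: "z - eval_vec ?m zs \<in> carrier_vec (length zs)"
    by (rule minus_carrier_vec[OF z eval_vec_carrier])
  have u: "u \<in> carrier_vec (length zs)" and Cu: "?C *\<^sub>v u = z - eval_vec ?m zs"
    unfolding u_def by (rule invertible_mat_solve[OF eval_mat_carrier inv' dz])+
  have x0: "x0 \<in> carrier_vec (length ys)" and Sx0: "?S *\<^sub>v x0 = d"
    unfolding x0_def by (rule invertible_mat_solve[OF eval_mat_carrier inv d])+
  note Bu = mult_mat_vec_carrier[OF eval_mat_carrier u, of K ys]
  have x: "x \<in> carrier_vec (length ys)" and Sx: "?S *\<^sub>v x = ?B *\<^sub>v u"
    unfolding x_def by (rule invertible_mat_solve[OF eval_mat_carrier inv Bu])+
  have w: "x0 - x \<in> carrier_vec (length ys)"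
    by (rule minus_carrier_vec[OF x0 x])
  have dims: "dim_vec y = length ys" "dim_vec z = length zs" "dim_vec u = length zs"
    using y z u carrier_vecD by blast+
  \<comment> \<open>The residual of the second stage is taken against the updated mean. Moving the
    extra term \<open>?B' *\<^sub>v x0\<close> to the other side turns the Schur equation
    \<open>Cu\<close> into the bottom rows \<open>bot\<close>.\<close>
  have m_zs: "eval_vec ?m zs = eval_vec m zs + ?B' *\<^sub>v x0"
    by (rule eq_vecI) (simp_all add: post_mean_def x0_def d_def)
  have top: "?S *\<^sub>v (x0 - x) + ?B *\<^sub>v u = y - eval_vec m ys"
    unfolding mult_minus_distrib_mat_vec[OF eval_mat_carrier x0 x] Sx0 Sx
    by (rule eq_vecI) (simp_all add: d_def)
  have bot: "?B' *\<^sub>v (x0 - x) + ?D *\<^sub>v u = z - eval_vec m zs"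
  proof (rule eq_vecI)
    fix i assume "i < dim_vec (z - eval_vec m zs)"
    then have i: "i < length zs" by simp
    have "vec_index (?D *\<^sub>v u - ?B' *\<^sub>v x) i = vec_index (z - (eval_vec m zs + ?B' *\<^sub>v x0)) i"
      using Cu unfolding eval_mat_post_cov_mult_vec[OF inv u] x_def[symmetric] m_zs by simp
    then show "vec_index (?B' *\<^sub>v (x0 - x) + ?D *\<^sub>v u) i = vec_index (z - eval_vec m zs) i"
      unfolding mult_minus_distrib_mat_vec[OF eval_mat_carrier x0 x] using i by simp
  qed simp
  have "eval_mat K (ys @ zs) (ys @ zs) *\<^sub>v ((x0 - x) @\<^sub>v u) = (y @\<^sub>v z) - eval_vec m (ys @ zs)"
    unfolding eval_mat_append_mult_vec[OF w u] top bot eval_vec_append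
    by (rule eq_vecI) (auto simp: dims)
  moreover have "(x0 - x) @\<^sub>v u \<in> carrier_vec (length (ys @ zs))"
    using append_carrier_vec[OF w u] by simp
  ultimately have "post_mean m K (ys @ zs) (y @\<^sub>v z) X =
      m X + scalar_prod (eval_vec (K X) (ys @ zs)) ((x0 - x) @\<^sub>v u)"
    by (rule post_mean_eqI[OF invertible_eval_mat_append[OF inv inv'], rotated])
  \<comment> \<open>The contributions of \<open>u\<close> and \<open>- x\<close> combine into the
    updated kernel row applied to \<open>u\<close>; what remains is the first-stage term in
    \<open>x0\<close>.\<close>
  also have "scalar_prod (eval_vec (K X) (ys @ zs)) ((x0 - x) @\<^sub>v u) =
      scalar_prod (eval_vec (K X) ys) x0 + scalar_prod (eval_vec (post_cov K ys X) zs) u"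
    unfolding eval_vec_append scalar_prod_append[OF eval_vec_carrier eval_vec_carrier w u]
      scalar_prod_minus_distrib[OF eval_vec_carrier x0 x] post_cov_scalar_prod[OF inv u] x_def[symmetric]
    by simp
  finally show ?thesis
    unfolding post_mean_def[of ?m] u_def[symmetric] by (simp add: post_mean_def x0_def d_def)
qed

text \<open>With \<open>Z\<close> fixed, both covariance updates are mean updates with zero data,
  and concatenated zero data are again zero. Thus the claim reduces to
  \<open>post_mean_append\<close>, without symmetry of \<open>K\<close>.\<close>

lemma post_cov_append:
  assumes inv: "invertible_mat (eval_mat K ys ys)"
    and inv': "invertible_mat (eval_mat (post_cov K ys) zs zs)"
  shows "post_cov (post_cov K ys) zs X Z = post_cov K (ys @ zs) X Z"
proof -
  let ?m = "\<lambda>p. K p Z"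
  have "(\<lambda>p. post_cov K ys p Z) = post_mean ?m K ys (0\<^sub>v (length ys))"
    using post_cov_eq_post_mean[OF inv] by blast
  then have "post_cov (post_cov K ys) zs X Z =
      post_mean (post_mean ?m K ys (0\<^sub>v (length ys))) (post_cov K ys) zs (0\<^sub>v (length zs)) X"
    using post_cov_eq_post_mean[OF inv', of X Z] by simp
  also have "\<dots> = post_mean ?m K (ys @ zs) (0\<^sub>v (length ys) @\<^sub>v 0\<^sub>v (length zs)) X"
    by (rule post_mean_append[OF inv inv' zero_carrier_vec zero_carrier_vec])
  also have "\<dots> = post_cov K (ys @ zs) X Z"
    using post_cov_eq_post_mean[OF invertible_eval_mat_append[OF inv inv'], of X Z]
    by (simp add: zero_vec_append)
  finally show ?thesis .
qed

section \<open>Linear operators acting on conditioned functions\<close>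

text \<open>
  Here \<open>Z r\<close> plays the role of \<open>L U r\<close>, and \<open>\<Phi>\<close> that of a mean, or of a covariance with one
  argument fixed, as a function of a random variable: \<open>L\<close> may be interchanged with \<open>\<Phi>\<close>.
\<close>

definition intertwines ::
  "'p set \<Rightarrow> ('p \<Rightarrow> real) set \<Rightarrow> (('p \<Rightarrow> real) \<Rightarrow> ('p \<Rightarrow> real)) \<Rightarrow> ('p \<Rightarrow> 'a) \<Rightarrow> ('p \<Rightarrow> 'a) \<Rightarrow>
   ('a \<Rightarrow> real) \<Rightarrow> bool" where
  "intertwines E W L U Z \<Phi> \<longleftrightarrow>
     (\<lambda>r. \<Phi> (U r)) \<in> W \<and> (\<forall>r\<in>E. L (\<lambda>r. \<Phi> (U r)) r = \<Phi> (Z r))"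

lemma linear_operator_onD:
  assumes "linear_operator_on E W L"
  shows "(\<lambda>_. 0) \<in> W"
    and "\<phi> \<in> W \<Longrightarrow> \<psi> \<in> W \<Longrightarrow> (\<lambda>r. \<phi> r + \<psi> r) \<in> W"
    and "\<phi> \<in> W \<Longrightarrow> \<psi> \<in> W \<Longrightarrow> r \<in> E \<Longrightarrow> L (\<lambda>r. \<phi> r + \<psi> r) r = L \<phi> r + L \<psi> r"
    and "\<phi> \<in> W \<Longrightarrow> (\<lambda>r. c * \<phi> r) \<in> W"
    and "\<phi> \<in> W \<Longrightarrow> r \<in> E \<Longrightarrow> L (\<lambda>r. c * \<phi> r) r = c * L \<phi> r"
    and "\<phi> \<in> W \<Longrightarrow> (\<And>r. r \<in> E \<Longrightarrow> \<psi> r = \<phi> r) \<Longrightarrow> \<psi> \<in> W"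
    and "\<phi> \<in> W \<Longrightarrow> (\<And>r. r \<in> E \<Longrightarrow> \<psi> r = \<phi> r) \<Longrightarrow> r \<in> E \<Longrightarrow> L \<psi> r = L \<phi> r"
  using assms unfolding linear_operator_on_def by blast+

text \<open>The given functions, such as \<open>\<mu>\<close>, match the values on random variables
  only on \<open>E\<close>. The clause of \<open>linear_operator_on\<close> on functions equal on
  \<open>E\<close> bridges the gap, here and in \<open>intertwinesD\<close>.\<close>

lemma intertwinesI:
  assumes lin: "linear_operator_on E W L" and \<phi>: "\<phi> \<in> W"
    and U: "\<And>r. r \<in> E \<Longrightarrow> \<Phi> (U r) = \<phi> r" and Z: "\<And>r. r \<in> E \<Longrightarrow> \<Phi> (Z r) = L \<phi> r"
  shows "intertwines E W L U Z \<Phi>"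
  unfolding intertwines_def
  using linear_operator_onD(6)[OF lin \<phi>, of "\<lambda>r. \<Phi> (U r)"] linear_operator_onD(7)[OF lin \<phi>, of "\<lambda>r. \<Phi> (U r)"] U Z
  by auto

lemma intertwinesD:
  assumes "intertwines E W L U Z \<Phi>" and "linear_operator_on E W L"
    and "\<And>r. r \<in> E \<Longrightarrow> \<phi> r = \<Phi> (U r)" and "r \<in> E"
  shows "L \<phi> r = \<Phi> (Z r)"
  using assms(1) linear_operator_onD(7)[OF assms(2) _ assms(3,4)] assms(4)
  unfolding intertwines_def by auto

lemma intertwines_add:
  assumes "linear_operator_on E W L" "intertwines E W L U Z \<Phi>" "intertwines E W L U Z \<Psi>"
  shows "intertwines E W L U Z (\<lambda>X. \<Phi> X + \<Psi> X)"
  using assms(2,3) linear_operator_onD(2,3)[OF assms(1)] unfolding intertwines_def by simp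

lemma intertwines_cmult:
  assumes "linear_operator_on E W L" "intertwines E W L U Z \<Phi>"
  shows "intertwines E W L U Z (\<lambda>X. c * \<Phi> X)"
  using assms(2) linear_operator_onD(4,5)[OF assms(1)] unfolding intertwines_def by simp

lemma intertwines_zero:
  assumes "linear_operator_on E W L"
  shows "intertwines E W L U Z (\<lambda>_. 0)"
  using linear_operator_onD(5)[OF assms linear_operator_onD(1)[OF assms], of _ 0]
    linear_operator_onD(1)[OF assms] unfolding intertwines_def by simp

lemma intertwines_sum:
  assumes "linear_operator_on E W L" and "finite I" and "\<And>i. i \<in> I \<Longrightarrow> intertwines E W L U Z (\<Phi> i)"
  shows "intertwines E W L U Z (\<lambda>X. \<Sum>i\<in>I. \<Phi> i X)"
  using assms(2,3)
  by (induction I) (simp_all add: intertwines_zero[OF assms(1)] intertwines_add[OF assms(1)])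

lemma intertwines_scalar_prod:
  assumes lin: "linear_operator_on E W L"
    and c: "\<And>Y. Y \<in> set ys \<Longrightarrow> intertwines E W L U Z (\<lambda>X. c X Y)"
    and w: "w \<in> carrier_vec (length ys)"
  shows "intertwines E W L U Z (\<lambda>X. scalar_prod (eval_vec (c X) ys) w)"
proof -
  have "intertwines E W L U Z (\<lambda>X. \<Sum>i\<in>{0..<length ys}. vec_index w i * c X (ys ! i))"
    by (intro intertwines_sum[OF lin] intertwines_cmult[OF lin] c) simp_all
  also have "(\<lambda>X. \<Sum>i\<in>{0..<length ys}. vec_index w i * c X (ys ! i)) =
      (\<lambda>X. scalar_prod (eval_vec (c X) ys) w)"
    using carrier_vecD[OF w] by (simp add: scalar_prod_def mult.commute)
  finally show ?thesis .
qed

text \<open>Only \<open>m\<close> and the kernel row depend on the argument. The solved weight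
  vector is constant in it, so the update adds a finite linear combination of kernel
  sections.\<close>

lemma intertwines_post_mean:
  assumes lin: "linear_operator_on E W L" and m: "intertwines E W L U Z m"
    and K: "\<And>Y. Y \<in> set ys \<Longrightarrow> intertwines E W L U Z (\<lambda>X. K X Y)"
    and inv: "invertible_mat (eval_mat K ys ys)" and y: "y \<in> carrier_vec (length ys)"
  shows "intertwines E W L U Z (post_mean m K ys y)"
  unfolding post_mean_def[abs_def]
  by (intro intertwines_add[OF lin m] intertwines_scalar_prod[OF lin] K
      invertible_mat_solve(1)[OF eval_mat_carrier inv] minus_carrier_vec[OF y eval_vec_carrier])

lemma intertwines_post_cov_left:
  assumes lin: "linear_operator_on E W L" and X: "intertwines E W L U Z (\<lambda>Y. K Y X)"
    and K: "\<And>Y. Y \<in> set ys \<Longrightarrow> intertwines E W L U Z (\<lambda>X. K X Y)"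
    and inv: "invertible_mat (eval_mat K ys ys)"
  shows "intertwines E W L U Z (\<lambda>Y. post_cov K ys Y X)"
  unfolding post_cov_eq_post_mean[OF inv]
  by (rule intertwines_post_mean[OF lin X K inv zero_carrier_vec])

text \<open>Here the varying argument sits inside the matrix-vector product. Transposing the inverse
  onto the fixed row at \<open>X\<close> again leaves constant weights.\<close>

lemma intertwines_post_cov_right:
  assumes lin: "linear_operator_on E W L" and X: "intertwines E W L U Z (K X)"
    and K: "\<And>Y. Y \<in> set ys \<Longrightarrow> intertwines E W L U Z (K Y)"
    and inv: "invertible_mat (eval_mat K ys ys)"
  shows "intertwines E W L U Z (post_cov K ys X)"
proof -
  let ?c = "transpose_mat (minv (eval_mat K ys ys)) *\<^sub>v eval_vec (K X) ys"
  note A = invertible_mat_minv(1)[OF eval_mat_carrier inv]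
  have c: "?c \<in> carrier_vec (length ys)"
    by (rule mult_mat_vec_carrier[OF transpose_carrier_mat[THEN iffD2, OF A] eval_vec_carrier])
  have "post_cov K ys X = (\<lambda>Y. K X Y + (- 1) * scalar_prod (eval_vec (\<lambda>p. K p Y) ys) ?c)"
    unfolding post_cov_def[abs_def] scalar_prod_mult_mat_vec_swap[OF A eval_vec_carrier eval_vec_carrier]
    by simp
  moreover have "intertwines E W L U Z \<dots>"
    by (intro intertwines_add[OF lin X] intertwines_cmult[OF lin] intertwines_scalar_prod[OF lin _ c] K)
  ultimately show ?thesis by simp
qed

section \<open>A single update step as conditioning of an abstract kernel\<close>

lemma eval_vec_map: "eval_vec \<phi> (map F ps) = eval_vec (\<lambda>p. \<phi> (F p)) ps"
  by (rule eq_vecI) simp_all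

lemma eval_mat_map: "eval_mat K (map F ps) (map G qs) = eval_mat (\<lambda>p q. K (F p) (G q)) ps qs"
  by (rule eq_matI) (simp_all add: eval_mat_def)

lemma eval_vec_cong: "(\<And>p. p \<in> set ps \<Longrightarrow> \<phi> p = \<psi> p) \<Longrightarrow> eval_vec \<phi> ps = eval_vec \<psi> ps"
  by (rule eq_vecI) simp_all

lemma eval_mat_cong:
  "(\<And>p q. p \<in> set ps \<Longrightarrow> q \<in> set qs \<Longrightarrow> K p q = K' p q) \<Longrightarrow> eval_mat K ps qs = eval_mat K' ps qs"
  by (rule eq_matI) (simp_all add: eval_mat_def)

text \<open>In use, \<open>S\<close> is the covariance function reached after some steps,
  \<open>K\<close> the kernel conditioned on the data assimilated so far, and \<open>Z\<close> the
  image of \<open>U\<close> under the operator of the next step.\<close>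

context
  fixes E :: "'p set" and W L and U Z :: "'p \<Rightarrow> 'a" and S :: "'p \<Rightarrow> 'p \<Rightarrow> real"
    and K :: "'a \<Rightarrow> 'a \<Rightarrow> real" and b v :: "'p list"
  assumes lin: "linear_operator_on E W L" and b: "set b \<subseteq> E" and v: "set v \<subseteq> E"
    and S: "\<And>r s. r \<in> E \<Longrightarrow> s \<in> E \<Longrightarrow> S r s = K (U r) (U s)"
    and left: "\<And>X. X \<in> U ` E \<union> Z ` E \<Longrightarrow> intertwines E W L U Z (\<lambda>Y. K Y X)"
    and right: "\<And>X. X \<in> U ` E \<union> Z ` E \<Longrightarrow> intertwines E W L U Z (K X)"
begin

lemma apply1_eq:
  assumes "r \<in> E" "s \<in> E"
  shows "apply1 L S r s = K (Z r) (U s)"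
  unfolding apply1_def using assms by (intro intertwinesD[OF left lin] S) auto

lemma apply2_eq:
  assumes "r \<in> E" "s \<in> E"
  shows "apply2 L S r s = K (U r) (Z s)"
  unfolding apply2_def using assms by (intro intertwinesD[OF right lin] S) auto

text \<open>The inner operator has already replaced \<open>U r\<close> by \<open>Z r\<close>, so
  \<open>right\<close> is needed at \<open>Z r\<close> and not only at values of
  \<open>U\<close>.\<close>

lemma apply2_apply1_eq:
  assumes "r \<in> E" "s \<in> E"
  shows "apply2 L (apply1 L S) r s = K (Z r) (Z s)"
  unfolding apply2_def using assms by (intro intertwinesD[OF right lin] apply1_eq) auto

lemma step_mat_eq:
  "step_mat S L b v = eval_mat K (map U b @ map Z v) (map U b @ map Z v)"
proof -
  have "eval_mat S b b = eval_mat (\<lambda>p q. K (U p) (U q)) b b"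
    "eval_mat (apply2 L S) b v = eval_mat (\<lambda>p q. K (U p) (Z q)) b v"
    "eval_mat (apply1 L S) v b = eval_mat (\<lambda>p q. K (Z p) (U q)) v b"
    "eval_mat (apply2 L (apply1 L S)) v v = eval_mat (\<lambda>p q. K (Z p) (Z q)) v v"
    using b v by (auto intro!: eval_mat_cong S apply1_eq apply2_eq apply2_apply1_eq)
  then show ?thesis unfolding step_mat_def eval_mat_append eval_mat_map by simp
qed

lemma step_row_eq:
  assumes "r \<in> E"
  shows "step_row S L b v r = eval_vec (K (U r)) (map U b @ map Z v)"
proof -
  have "eval_vec (S r) b = eval_vec (\<lambda>p. K (U r) (U p)) b"
    "eval_vec (apply2 L S r) v = eval_vec (\<lambda>p. K (U r) (Z p)) v"
    using assms b v by (auto intro!: eval_vec_cong S apply2_eq)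
  then show ?thesis unfolding step_row_def eval_vec_append eval_vec_map by simp
qed

lemma step_col_eq:
  assumes "s \<in> E"
  shows "step_col S L b v s = eval_vec (\<lambda>X. K X (U s)) (map U b @ map Z v)"
proof -
  have "eval_vec (\<lambda>p. S p s) b = eval_vec (\<lambda>p. K (U p) (U s)) b"
    "eval_vec (\<lambda>p. apply1 L S p s) v = eval_vec (\<lambda>p. K (Z p) (U s)) v"
    using assms b v by (auto intro!: eval_vec_cong S apply1_eq)
  then show ?thesis unfolding step_col_def eval_vec_append eval_vec_map by simp
qed

lemma step_cov_eq:
  assumes "r \<in> E" "s \<in> E"
  shows "step_cov S L b v r s = post_cov K (map U b @ map Z v) (U r) (U s)"
  using assms by (simp add: step_cov_def post_cov_def step_mat_eq step_row_eq step_col_eq S)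

lemma step_mean_eq:
  assumes m: "intertwines E W L U Z m" and \<nu>: "\<And>r. r \<in> E \<Longrightarrow> \<nu> r = m (U r)" and r: "r \<in> E"
  shows "step_mean \<nu> S L b v h f r =
    post_mean m K (map U b @ map Z v) (eval_vec h b @\<^sub>v eval_vec f v) (U r)"
proof -
  have "eval_vec \<nu> b = eval_vec (\<lambda>p. m (U p)) b" "eval_vec (L \<nu>) v = eval_vec (\<lambda>p. m (Z p)) v"
    using b v by (auto intro!: eval_vec_cong \<nu> intertwinesD[OF m lin])
  then have "(eval_vec h b - eval_vec \<nu> b) @\<^sub>v (eval_vec f v - eval_vec (L \<nu>) v) =
      (eval_vec h b @\<^sub>v eval_vec f v) - eval_vec m (map U b @ map Z v)"
    unfolding eval_vec_append eval_vec_map by (intro eq_vecI) auto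
  then show ?thesis
    using r by (simp add: step_mean_def post_mean_def step_mat_eq step_row_eq \<nu>)
qed

end

section \<open>The sequential procedure\<close>

lemma stack_Suc:
  "stack (Suc n) a b v F G H = stack n a b v F G H @ map G (b n) @ map (H n) (v n)"
  by (simp add: stack_def)

lemma set_stack_subset:
  assumes "set a \<subseteq> E" and "\<And>i. i < n \<Longrightarrow> set (b i) \<subseteq> E \<and> set (v i) \<subseteq> E"
  shows "set (stack n a b v U U Z) \<subseteq> U ` E \<union> (\<Union>i<n. Z i ` E)"
  using assms by (fastforce simp: stack_def)

text \<open>Matches the length of the data vector with the number of observed variables, two stacks
  with entries of different types.\<close>

lemma length_stack: "length (stack n a b v F G H) = length (stack n a b v F' G' H')"
  by (induction n) (simp_all add: stack_Suc, simp add: stack_def)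

text \<open>Induction on the number of completed steps. Invertibility of the stacked matrix is
  carried along because appending the next block requires it for the earlier ones. The set
  \<open>obs\<close> is fixed by \<open>n\<close>, so the same interchange hypotheses serve every
  stage.\<close>

lemma seq_eq_post:
  fixes E :: "'p set" and U :: "'p \<Rightarrow> 'a" and Z :: "nat \<Rightarrow> 'p \<Rightarrow> 'a" and m :: "'a \<Rightarrow> real"
    and n :: nat and a :: "'p list" and b v :: "nat \<Rightarrow> 'p list" and g h f :: "'p \<Rightarrow> real"
  defines "obs \<equiv> U ` E \<union> (\<Union>i<n. Z i ` E)"
  assumes lin: "\<And>i. i < n \<Longrightarrow> linear_operator_on E (W i) (D i)"
    and a: "set a \<subseteq> E" and b: "\<And>i. i < n \<Longrightarrow> set (b i) \<subseteq> E" and v: "\<And>i. i < n \<Longrightarrow> set (v i) \<subseteq> E"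
    and S: "\<And>r s. r \<in> E \<Longrightarrow> s \<in> E \<Longrightarrow> S r s = K (U r) (U s)"
    and \<mu>: "\<And>r. r \<in> E \<Longrightarrow> \<mu> r = m (U r)"
    and left: "\<And>i X. i < n \<Longrightarrow> X \<in> obs \<Longrightarrow> intertwines E (W i) (D i) U (Z i) (\<lambda>Y. K Y X)"
    and right: "\<And>i X. i < n \<Longrightarrow> X \<in> obs \<Longrightarrow> intertwines E (W i) (D i) U (Z i) (K X)"
    and m: "\<And>i. i < n \<Longrightarrow> intertwines E (W i) (D i) U (Z i) m"
    and inv_init: "invertible_mat (eval_mat S a a)"
    and inv_step: "\<And>i. i < n \<Longrightarrow> invertible_mat (step_mat (seq_cov S D a b v i) (D i) (b i) (v i))"
    and k: "k \<le> n"
  defines "ys \<equiv> \<lambda>k. stack k a b v U U Z" and "d \<equiv> \<lambda>k. vec_of_list (stack k a b v g h (\<lambda>_. f))"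
  shows "invertible_mat (eval_mat K (ys k) (ys k))"
    and "\<And>r s. r \<in> E \<Longrightarrow> s \<in> E \<Longrightarrow> seq_cov S D a b v k r s = post_cov K (ys k) (U r) (U s)"
    and "\<And>r. r \<in> E \<Longrightarrow> seq_mean \<mu> S D a b v g h f k r = post_mean m K (ys k) (d k) (U r)"
proof -
  have "invertible_mat (eval_mat K (ys k) (ys k)) \<and>
    (\<forall>r\<in>E. \<forall>s\<in>E. seq_cov S D a b v k r s = post_cov K (ys k) (U r) (U s)) \<and>
    (\<forall>r\<in>E. seq_mean \<mu> S D a b v g h f k r = post_mean m K (ys k) (d k) (U r))"
    using k
  proof (induction k)
    case 0
    have ys0: "ys 0 = map U a" and d0: "d 0 = eval_vec g a"
      by (simp_all add: ys_def d_def stack_def eval_vec_def)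
    have mat: "eval_mat S a a = eval_mat K (ys 0) (ys 0)"
      unfolding ys0 eval_mat_map using a by (auto intro!: eval_mat_cong S)
    have row: "eval_vec (S r) a = eval_vec (K (U r)) (ys 0)"
      and col: "eval_vec (\<lambda>p. S p r) a = eval_vec (\<lambda>p. K p (U r)) (ys 0)" if "r \<in> E" for r
      unfolding ys0 eval_vec_map using a that by (auto intro!: eval_vec_cong S)
    have mean: "eval_vec \<mu> a = eval_vec m (ys 0)"
      unfolding ys0 eval_vec_map using a by (auto intro!: eval_vec_cong \<mu>)
    show ?case
      using inv_init
      by (simp add: init_cov_def init_mean_def post_cov_def post_mean_def mat row col mean S \<mu> d0)
  next
    case (Suc k)
    let ?S = "seq_cov S D a b v k" and ?m = "post_mean m K (ys k) (d k)" and ?K = "post_cov K (ys k)"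
    let ?zs = "map U (b k) @ map (Z k) (v k)" and ?z = "eval_vec h (b k) @\<^sub>v eval_vec f (v k)"
    have kn: "k < n" using Suc.prems by simp
    have inv: "invertible_mat (eval_mat K (ys k) (ys k))"
      and cov: "\<And>r s. r \<in> E \<Longrightarrow> s \<in> E \<Longrightarrow> ?S r s = ?K (U r) (U s)"
      and mean: "\<And>r. r \<in> E \<Longrightarrow> seq_mean \<mu> S D a b v g h f k r = ?m (U r)"
      using Suc.IH kn by simp_all
    have "set (ys k) \<subseteq> U ` E \<union> (\<Union>i<k. Z i ` E)"
      unfolding ys_def using a b v kn by (intro set_stack_subset) auto
    then have ys_obs: "X \<in> obs" if "X \<in> set (ys k)" for X
      using that kn by (fastforce simp: obs_def)
    have d: "d k \<in> carrier_vec (length (ys k))"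
      unfolding d_def ys_def by (intro carrier_vecI) (simp only: dim_vec_of_list, rule length_stack)
    have obs: "X \<in> obs" if "X \<in> U ` E \<union> Z k ` E" for X
      using that kn by (auto simp: obs_def)
    \<comment> \<open>Interchange with \<open>D k\<close> is not part of the induction hypothesis.
      It is derived afresh from the unconditioned \<open>m\<close> and \<open>K\<close>, from which
      \<open>?m\<close> and \<open>?K\<close> arise as linear combinations.\<close>
    have m': "intertwines E (W k) (D k) U (Z k) ?m"
      using kn ys_obs by (intro intertwines_post_mean lin m left inv d) auto
    have left': "intertwines E (W k) (D k) U (Z k) (\<lambda>Y. ?K Y X)" if "X \<in> U ` E \<union> Z k ` E" for X
      using kn ys_obs obs[OF that] by (intro intertwines_post_cov_left lin left inv) auto
    have right': "intertwines E (W k) (D k) U (Z k) (?K X)" if "X \<in> U ` E \<union> Z k ` E" for X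
      using kn ys_obs obs[OF that] by (intro intertwines_post_cov_right lin right inv) auto
    note step = lin[OF kn] b[OF kn] v[OF kn] cov left' right'
    \<comment> \<open>The matrix inverted in this step is exactly the Schur complement of the block
      already stacked.\<close>
    have inv': "invertible_mat (eval_mat ?K ?zs ?zs)"
      using inv_step[OF kn] step_mat_eq[OF step] by simp
    have ys: "ys (Suc k) = ys k @ ?zs" and dz: "d (Suc k) = d k @\<^sub>v ?z"
      by (simp_all only: ys_def d_def stack_Suc vec_of_list_append eval_vec_def)
    have z: "?z \<in> carrier_vec (length ?zs)"
      using append_carrier_vec[OF eval_vec_carrier eval_vec_carrier, of h "b k" f "v k"] by simp
    have "seq_cov S D a b v (Suc k) r s = post_cov K (ys (Suc k)) (U r) (U s)"
      if "r \<in> E" "s \<in> E" for r s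
      using step_cov_eq[OF step that] by (simp add: ys post_cov_append[OF inv inv'])
    moreover have "seq_mean \<mu> S D a b v g h f (Suc k) r = post_mean m K (ys (Suc k)) (d (Suc k)) (U r)"
      if "r \<in> E" for r
      using step_mean_eq[OF step m' mean that] by (simp add: ys dz post_mean_append[OF inv inv' d z])
    ultimately show ?case
      using invertible_eval_mat_append[OF inv inv'] by (simp add: ys)
  qed
  then show "invertible_mat (eval_mat K (ys k) (ys k))"
    and "\<And>r s. r \<in> E \<Longrightarrow> s \<in> E \<Longrightarrow> seq_cov S D a b v k r s = post_cov K (ys k) (U r) (U s)"
    and "\<And>r. r \<in> E \<Longrightarrow> seq_mean \<mu> S D a b v g h f k r = post_mean m K (ys k) (d k) (U r)"
    by blast+
qed

section \<open>Application to the Gaussian process\<close>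

lemma cov_commute: "cov M X Y = cov M Y X"
  by (simp add: cov_def mult.commute)

lemma gaussian_process_cong:
  assumes "\<And>r. r \<in> E \<Longrightarrow> \<mu> r = \<mu>' r" and "\<And>r s. r \<in> E \<Longrightarrow> s \<in> E \<Longrightarrow> K r s = K' r s"
  shows "gaussian_process M E U \<mu> K \<longleftrightarrow> gaussian_process M E U \<mu>' K'"
  using assms unfolding gaussian_process_def by simp

text \<open>Instantiates \<open>seq_eq_post\<close> with random variables as indices,
  \<open>cov M\<close> as kernel and \<open>mean M\<close> as mean. Equality in distribution is
  stated through an arbitrary process \<open>V\<close> on \<open>N\<close>; it follows because
  \<open>gaussian_process\<close> sees the mean and covariance only on \<open>E\<close>.\<close>

theorem lemma1:
  fixes T :: real
    and \<Gamma> :: "(real ^ 'd) set"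
    and E :: "(real \<times> (real ^ 'd)) set"
    and n :: nat
    and t :: "nat \<Rightarrow> real"
    and xs :: "(real ^ 'd) list"
    and a0 :: "(real \<times> (real ^ 'd)) list"
    and b v :: "nat \<Rightarrow> (real \<times> (real ^ 'd)) list"
    and g h f :: "real \<times> (real ^ 'd) \<Rightarrow> real"
    and W :: "nat \<Rightarrow> (real \<times> (real ^ 'd) \<Rightarrow> real) set"
    and D :: "nat \<Rightarrow> (real \<times> (real ^ 'd) \<Rightarrow> real) \<Rightarrow> (real \<times> (real ^ 'd) \<Rightarrow> real)"
    and M :: "'w measure"
    and U :: "real \<times> (real ^ 'd) \<Rightarrow> 'w \<Rightarrow> real"
    and \<mu> :: "real \<times> (real ^ 'd) \<Rightarrow> real"
    and \<Sigma> :: "real \<times> (real ^ 'd) \<Rightarrow> real \<times> (real ^ 'd) \<Rightarrow> real"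
    and Ys :: "('w \<Rightarrow> real) list"
    and y :: "real Matrix.vec"
    and \<mu>seq \<mu>all :: "real \<times> (real ^ 'd) \<Rightarrow> real"
    and \<Sigma>seq \<Sigma>all :: "real \<times> (real ^ 'd) \<Rightarrow> real \<times> (real ^ 'd) \<Rightarrow> real"
    and N :: "'u measure"
    and V :: "real \<times> (real ^ 'd) \<Rightarrow> 'u \<Rightarrow> real"
  assumes T_pos: "0 < T"
    and \<Gamma>: "open \<Gamma>" "bounded \<Gamma>"
    and E_eq: "E = {0..T} \<times> (\<Gamma> \<union> frontier \<Gamma>)"
    and times: "0 < n" "t 0 = 0" "\<And>i. Suc i < n \<Longrightarrow> t i < t (Suc i)" "t (n - 1) \<le> T"
    and points: "distinct xs" "set xs \<subseteq> \<Gamma> \<union> frontier \<Gamma>"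
    and a0_eq: "a0 = map (Pair (t 0)) (filter (\<lambda>x. x \<notin> frontier \<Gamma>) xs)"
    and b_eq: "b = (\<lambda>i. map (Pair (t i)) (filter (\<lambda>x. x \<in> frontier \<Gamma>) xs))"
    and v_eq: "v = (\<lambda>i. map (Pair (t i)) xs)"
    and U_gp: "gaussian_process M E U \<mu> \<Sigma>"
    and D_linear: "\<And>i. i < n \<Longrightarrow> linear_operator_on E (W i) (D i)"
    and reg_mean: "\<And>i. i < n \<Longrightarrow> \<mu> \<in> W i"
    and reg_cov: "\<And>i s. i < n \<Longrightarrow> s \<in> E \<Longrightarrow> (\<lambda>r. \<Sigma> r s) \<in> W i \<and> (\<lambda>r. \<Sigma> s r) \<in> W i"
    and reg_cov_op: "\<And>i j s. i < n \<Longrightarrow> j < n \<Longrightarrow> s \<in> E \<Longrightarrow>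
          (\<lambda>r. apply2 (D j) \<Sigma> r s) \<in> W i \<and> (\<lambda>r. apply1 (D j) \<Sigma> s r) \<in> W i"
    and reg_paths: "\<And>i. i < n \<Longrightarrow> AE w in M. (\<lambda>r. U r w) \<in> W i"
    and commute: "\<And>i j r s. i < n \<Longrightarrow> j < n \<Longrightarrow> r \<in> E \<Longrightarrow> s \<in> E \<Longrightarrow>
          apply2 (D j) (apply1 (D i) \<Sigma>) r s = apply1 (D i) (apply2 (D j) \<Sigma>) r s"
    and joint: "gaussian_family M (E <+> ({..<n} \<times> E))
          (case_sum U (\<lambda>(i, r). apply_process (D i) U r))"
    and mean_op: "\<And>i r. i < n \<Longrightarrow> r \<in> E \<Longrightarrow> mean M (apply_process (D i) U r) = D i \<mu> r"
    and cov_op: "\<And>i r s. i < n \<Longrightarrow> r \<in> E \<Longrightarrow> s \<in> E \<Longrightarrow>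
          cov M (apply_process (D i) U r) (U s) = apply1 (D i) \<Sigma> r s"
    and cov_op_op: "\<And>i j r s. i < n \<Longrightarrow> j < n \<Longrightarrow> r \<in> E \<Longrightarrow> s \<in> E \<Longrightarrow>
          cov M (apply_process (D i) U r) (apply_process (D j) U s) =
          apply2 (D j) (apply1 (D i) \<Sigma>) r s"
    and inv_init: "invertible_mat (eval_mat \<Sigma> a0 a0)"
    and inv_step: "\<And>i. i < n \<Longrightarrow>
          invertible_mat (step_mat (seq_cov \<Sigma> D a0 b v i) (D i) (b i) (v i))"
    and \<mu>seq_eq: "\<mu>seq = seq_mean \<mu> \<Sigma> D a0 b v g h f n"
    and \<Sigma>seq_eq: "\<Sigma>seq = seq_cov \<Sigma> D a0 b v n"
    and Ys_eq: "Ys = stack n a0 b v U U (\<lambda>i. apply_process (D i) U)"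
    and y_eq: "y = vec_of_list (stack n a0 b v g h (\<lambda>_. f))"
    and inv_all: "invertible_mat (obs_cov M Ys)"
    and \<mu>all_eq: "\<mu>all = cond_mean M U \<mu> Ys y"
    and \<Sigma>all_eq: "\<Sigma>all = cond_cov M U \<Sigma> Ys"
  shows "(\<forall>r\<in>E. \<mu>seq r = \<mu>all r) \<and> (\<forall>r\<in>E. \<forall>s\<in>E. \<Sigma>seq r s = \<Sigma>all r s) \<and>
         (gaussian_process N E V \<mu>seq \<Sigma>seq \<longleftrightarrow> gaussian_process N E V \<mu>all \<Sigma>all)"
proof -
  let ?Z = "\<lambda>i. apply_process (D i) U"
  define obs where "obs = U ` E \<union> (\<Union>i<n. ?Z i ` E)"
  have mean: "mean M (U r) = \<mu> r" if "r \<in> E" for r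
    using U_gp that unfolding gaussian_process_def by blast
  have cov: "cov M (U r) (U s) = \<Sigma> r s" if "r \<in> E" "s \<in> E" for r s
    using U_gp that unfolding gaussian_process_def by blast
  have t_mono: "t i \<le> t j" if "i \<le> j" "j < n" for i j
    using that
  proof (induction j)
    case (Suc j)
    then show ?case using times(3)[of j] by (cases "i = Suc j") auto
  qed simp
  have time: "t i \<in> {0..T}" if "i < n" for i
    using t_mono[of 0 i] t_mono[of i "n - 1"] times(1,2,4) that by force
  have a: "set a0 \<subseteq> E"
    using time[OF times(1)] points(2) by (auto simp: a0_eq E_eq)
  have b: "set (b i) \<subseteq> E" and v: "set (v i) \<subseteq> E" if "i < n" for i
    using time[OF that] points(2) by (auto simp: b_eq v_eq E_eq)
  have left: "intertwines E (W i) (D i) U (?Z i) (\<lambda>Y. cov M Y X)" if i: "i < n" and X: "X \<in> obs" for i X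
    using X unfolding obs_def
  proof (elim UnE imageE UN_E)
    fix s assume s: "X = U s" "s \<in> E"
    show ?thesis
    proof (rule intertwinesI[OF D_linear[OF i]])
      show "(\<lambda>r. \<Sigma> r s) \<in> W i" using reg_cov[OF i s(2)] by blast
    qed (use s i in \<open>simp_all add: cov cov_op apply1_def\<close>)
  next
    fix j s assume j: "j \<in> {..<n}" and s: "X = ?Z j s" "s \<in> E"
    \<comment> \<open>For an operator observation, symmetry puts \<open>?Z j s\<close> first:
      \<open>cov_op\<close> then gives the values at \<open>U r\<close>, and
      \<open>cov_op_op\<close> with \<open>i\<close> and \<open>j\<close> exchanged gives their
      image under \<open>D i\<close>.\<close>
    show ?thesis
    proof (rule intertwinesI[OF D_linear[OF i]])
      show "(\<lambda>r. apply1 (D j) \<Sigma> s r) \<in> W i" using reg_cov_op[OF i _ s(2)] j by blast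
    qed (use s i j in \<open>simp_all add: cov_commute[of M _ "?Z j s"] cov_op cov_op_op apply2_def\<close>)
  qed
  \<comment> \<open>By symmetry of \<open>cov M\<close> the two arguments need no separate
    treatment.\<close>
  then have right: "intertwines E (W i) (D i) U (?Z i) (cov M X)" if "i < n" "X \<in> obs" for i X
    using that by (simp add: cov_commute[of M X, abs_def])
  have m: "intertwines E (W i) (D i) U (?Z i) (mean M)" if "i < n" for i
    using that by (intro intertwinesI[OF D_linear reg_mean]) (simp_all add: mean mean_op)
  note post = seq_eq_post[of n E W D a0 b v \<Sigma> "cov M" U \<mu> "mean M" ?Z, folded obs_def]
  \<comment> \<open>The final \<open>order_refl\<close> closes \<open>k \<le> n\<close> at
    \<open>k = n\<close>, the end of the procedure.\<close>
  note prems = D_linear a b v cov[symmetric] mean[symmetric] left right m inv_init inv_step order_refl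
  have seq_cov: "seq_cov \<Sigma> D a0 b v n r s = post_cov (cov M) (stack n a0 b v U U ?Z) (U r) (U s)"
    if "r \<in> E" "s \<in> E" for r s
    using that by - (rule post(2), (assumption | rule prems)+)
  have seq_mean: "seq_mean \<mu> \<Sigma> D a0 b v g h f n r = post_mean (mean M) (cov M) (stack n a0 b v U U ?Z)
      (vec_of_list (stack n a0 b v g h (\<lambda>_. f))) (U r)"
    if "r \<in> E" for r
    using that by - (rule post(3), (assumption | rule prems)+)
  have "cond_cov M U \<Sigma> Ys r s = post_cov (cov M) Ys (U r) (U s)" if "r \<in> E" "s \<in> E" for r s
  proof -
    \<comment> \<open>\<open>cond_cov\<close> uses a cross-covariance row for both arguments,
      \<open>post_cov\<close> a kernel column for the second; symmetry identifies them.\<close>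
    have "eval_vec (cov M (U s)) Ys = eval_vec (\<lambda>X. cov M X (U s)) Ys"
      by (intro eval_vec_cong cov_commute)
    then show ?thesis
      using that unfolding cond_cov_def post_cov_def cross_cov_def obs_cov_def by (simp add: cov)
  qed
  then have covs: "\<Sigma>seq r s = \<Sigma>all r s" if "r \<in> E" "s \<in> E" for r s
    using seq_cov[OF that] that by (simp add: \<Sigma>seq_eq \<Sigma>all_eq Ys_eq)
  have "cond_mean M U \<mu> Ys y r = post_mean (mean M) (cov M) Ys y (U r)" if "r \<in> E" for r
    using that unfolding cond_mean_def post_mean_def cross_cov_def obs_cov_def obs_mean_def
    by (simp add: mean)
  then have means: "\<mu>seq r = \<mu>all r" if "r \<in> E" for r
    using seq_mean[OF that] that by (simp add: \<mu>seq_eq \<mu>all_eq Ys_eq y_eq)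
  show ?thesis
    using means covs gaussian_process_cong[of E \<mu>seq \<mu>all \<Sigma>seq \<Sigma>all N V] by blast
qed

end
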